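(* In the monopolist disclosure game described in the context with the simple evidence structure, i.e. $\mathcal M(t)=\{T,\{t\}\}$ for every $t\in T$, the following holds. In every Perfect Bayesian Equilibrium and for every type $t\in T$, the interim (equilibrium) payoff of the consumer of type $t$ is at most $\max\{v(t)-p^*,0\}$.
   Context: Pricing problem. A monopolist sells a good to one consumer with unit demand. The consumer's type $t$ is drawn from a probability measure $\mu$ with support $T$, a convex and compact subset of $\mathbb R^k$. The consumer's valuation is $v(t)$, where $v:T\to\mathbb R$ is a (measurable) non-negative quasiconvex function. If type $t$ buys at price $p$, her payoff is $v(t)-p$ and the monopolist's payoff is $p$; otherwise both get $0$. Let $F(\tilde v)=\mu(\{t\in T: v(t)\le \tilde v\})$ be the induced CDF of valuations, and let $\underline v$ and $\overline v$ be the lowest and highest valuations in the support. It is assumed that $F$ is continuous and $F(\underline v)=0$. Let $p^*$ be the lowest maximizer of $p(1-F(p))$ over $p\ge 0$ (the lowest optimal monopoly price when communication is impossible). Disclosure game. The consumer observes $t$ and chooses a message $M\in\mathcal M(t)$, where $\mathcal M(t)$ is a set of closed convex subsets of $T$. The monopolist observes only $M$ and chooses a price $p\ge0$. The consumer then decides whether to buy; she buys when indifferent. Perfect Bayesian Equilibrium (PBE): the monopolist's beliefs are updated by Bayes' rule whenever possible; after every message $M$ (on or off path) his belief is supported in $\{t\in T: M\in\mathcal M(t)\}$; and the consumer and the monopolist behave sequentially rationally (no commitment). *)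

theory Defs
  imports "HOL-Probability.Probability"
begin

definition measure_support :: "'a::topological_space measure \<Rightarrow> 'a set" where
  "measure_support M = {x. \<forall>U. open U \<and> x \<in> U \<longrightarrow> emeasure M U > 0}"

definition quasiconvex_on :: "'a::real_vector set \<Rightarrow> ('a \<Rightarrow> real) \<Rightarrow> bool" where
  "quasiconvex_on S f \<longleftrightarrow> convex S \<and>
     (\<forall>x\<in>S. \<forall>y\<in>S. \<forall>u. 0 \<le> u \<and> u \<le> 1 \<longrightarrow>
        f ((1 - u) *\<^sub>R x + u *\<^sub>R y) \<le> max (f x) (f y))"

definition valuation_cdf ::
  "(real ^ 'k) set \<Rightarrow> (real ^ 'k) measure \<Rightarrow> (real ^ 'k \<Rightarrow> real) \<Rightarrow> real \<Rightarrow> real" where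
  "valuation_cdf T \<mu> v x = measure \<mu> {t \<in> T. v t \<le> x}"

text \<open>The support of the law of the valuation is closed, nonempty and (for non-negative
  valuations) bounded below, so the infimum is a minimum.\<close>

definition lowest_valuation ::
  "(real ^ 'k) set \<Rightarrow> (real ^ 'k) measure \<Rightarrow> (real ^ 'k \<Rightarrow> real) \<Rightarrow> real" where
  "lowest_valuation T \<mu> v = Inf (measure_support (distr (restrict_space \<mu> T) borel v))"

text \<open>The function \<open>v\<close> is total, but only its values on \<open>T\<close> matter anywhere.\<close>

locale pricing_problem = prob_space \<mu>
  for T :: "(real ^ 'k) set" and \<mu> :: "(real ^ 'k) measure" and v :: "real ^ 'k \<Rightarrow> real" +
  assumes sets_prior: "sets \<mu> = sets borel"
    and convex_types: "convex T"
    and compact_types: "compact T"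
    and prior_support: "measure_support \<mu> = T"
    and valuation_measurable: "v \<in> borel_measurable (restrict_space borel T)"
    and valuation_nonneg: "\<And>t. t \<in> T \<Longrightarrow> 0 \<le> v t"
    and valuation_quasiconvex: "quasiconvex_on T v"
    and cdf_continuous: "continuous_on UNIV (valuation_cdf T \<mu> v)"
    and cdf_lowest: "valuation_cdf T \<mu> v (lowest_valuation T \<mu> v) = 0"

definition optimal_monopoly_price ::
  "(real ^ 'k) set \<Rightarrow> (real ^ 'k) measure \<Rightarrow> (real ^ 'k \<Rightarrow> real) \<Rightarrow> real \<Rightarrow> bool" where
  "optimal_monopoly_price T \<mu> v p \<longleftrightarrow> 0 \<le> p \<and>
     (\<forall>p'\<ge>0. p' * (1 - valuation_cdf T \<mu> v p') \<le> p * (1 - valuation_cdf T \<mu> v p))"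

definition lowest_optimal_monopoly_price ::
  "(real ^ 'k) set \<Rightarrow> (real ^ 'k) measure \<Rightarrow> (real ^ 'k \<Rightarrow> real) \<Rightarrow> real \<Rightarrow> bool" where
  "lowest_optimal_monopoly_price T \<mu> v p \<longleftrightarrow> optimal_monopoly_price T \<mu> v p \<and>
     (\<forall>p'. optimal_monopoly_price T \<mu> v p' \<longrightarrow> p \<le> p')"

locale disclosure_game = pricing_problem T \<mu> v
  for T :: "(real ^ 'k) set" and \<mu> v +
  fixes Ev :: "real ^ 'k \<Rightarrow> (real ^ 'k) set set"
  assumes evidence: "\<And>t M. t \<in> T \<Longrightarrow> M \<in> Ev t \<Longrightarrow> M \<subseteq> T \<and> closed M \<and> convex M"

definition simple_evidence :: "'a set \<Rightarrow> 'a \<Rightarrow> 'a set set" where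
  "simple_evidence T t = {T, {t}}"

lemma (in pricing_problem) disclosure_game_simple_evidence:
  "disclosure_game T \<mu> v (simple_evidence T)"
  by unfold_locales
    (use convex_types compact_types in \<open>auto simp: simple_evidence_def compact_imp_closed\<close>)

definition type_space :: "'a::topological_space set \<Rightarrow> 'a measure" where
  "type_space T = restrict_space borel T"

text \<open>The feasible messages, with the Effros sigma-algebra, which on nonempty compact sets
  is the Borel sigma-algebra of the Hausdorff metric.\<close>

definition message_space ::
  "'a::topological_space set \<Rightarrow> ('a \<Rightarrow> 'a set set) \<Rightarrow> 'a set measure" where
  "message_space T Ev = sigma (\<Union>t\<in>T. Ev t)
     {{M \<in> (\<Union>t\<in>T. Ev t). M \<inter> U \<noteq> {}} | U. open U}"

definition price_space :: "real measure" where
  "price_space = restrict_space borel {0..}"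

text \<open>
  An assessment consists of
  \<^item> \<open>\<sigma>\<close>: the consumer's (possibly mixed) disclosure strategy, a Markov kernel from types to messages;
  \<^item> \<open>\<beta>\<close>: the monopolist's belief about the type after each message;
  \<^item> \<open>\<pi>\<close>: the monopolist's (possibly mixed) pricing strategy, a Markov kernel from messages to prices;
  \<^item> \<open>b\<close>: the consumer's purchase decision \<open>b t M p\<close> as type \<open>t\<close>, after sending \<open>M\<close> and being
    offered \<open>p\<close>. A deterministic decision loses nothing: outside of ties the optimum is
    unique, and ties are broken in favour of buying.
\<close>

definition purchase_payoff ::
  "('a \<Rightarrow> real) \<Rightarrow> ('a \<Rightarrow> 'a set \<Rightarrow> real \<Rightarrow> bool) \<Rightarrow> 'a \<Rightarrow> 'a set \<Rightarrow> real \<Rightarrow> real" where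
  "purchase_payoff v b t M p = (if b t M p then v t - p else 0)"

definition message_payoff ::
  "('a \<Rightarrow> real) \<Rightarrow> ('a set \<Rightarrow> real measure) \<Rightarrow> ('a \<Rightarrow> 'a set \<Rightarrow> real \<Rightarrow> bool) \<Rightarrow>
     'a \<Rightarrow> 'a set \<Rightarrow> real" where
  "message_payoff v \<pi> b t M = (\<integral>p. purchase_payoff v b t M p \<partial>\<pi> M)"

definition interim_payoff ::
  "('a \<Rightarrow> real) \<Rightarrow> ('a \<Rightarrow> 'a set measure) \<Rightarrow> ('a set \<Rightarrow> real measure) \<Rightarrow>
     ('a \<Rightarrow> 'a set \<Rightarrow> real \<Rightarrow> bool) \<Rightarrow> 'a \<Rightarrow> real" where
  "interim_payoff v \<sigma> \<pi> b t = (\<integral>M. message_payoff v \<pi> b t M \<partial>\<sigma> t)"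

definition expected_revenue ::
  "'a set \<Rightarrow> ('a set \<Rightarrow> 'a measure) \<Rightarrow> ('a \<Rightarrow> 'a set \<Rightarrow> real \<Rightarrow> bool) \<Rightarrow> 'a set \<Rightarrow> real \<Rightarrow> real" where
  "expected_revenue T \<beta> b M p = p * measure (\<beta> M) {t \<in> T. b t M p}"

definition assessment ::
  "(real ^ 'k) set \<Rightarrow> (real ^ 'k \<Rightarrow> (real ^ 'k) set set) \<Rightarrow>
   (real ^ 'k \<Rightarrow> (real ^ 'k) set measure) \<Rightarrow> ((real ^ 'k) set \<Rightarrow> (real ^ 'k) measure) \<Rightarrow>
   ((real ^ 'k) set \<Rightarrow> real measure) \<Rightarrow> (real ^ 'k \<Rightarrow> (real ^ 'k) set \<Rightarrow> real \<Rightarrow> bool) \<Rightarrow> bool" where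
  "assessment T Ev \<sigma> \<beta> \<pi> b \<longleftrightarrow>
     \<sigma> \<in> measurable (type_space T) (prob_algebra (message_space T Ev)) \<and>
     (\<forall>t\<in>T. AE M in \<sigma> t. M \<in> Ev t) \<and>
     \<beta> \<in> measurable (message_space T Ev) (prob_algebra (type_space T)) \<and>
     \<pi> \<in> measurable (message_space T Ev) (prob_algebra price_space) \<and>
     Measurable.pred (type_space T \<Otimes>\<^sub>M message_space T Ev \<Otimes>\<^sub>M price_space) (\<lambda>(t, M, p). b t M p)"

text \<open>The first conjunct says that \<open>\<beta>\<close> is a regular conditional distribution of the type given the
  message; for a message \<open>M\<close> of positive probability it forces
  \<open>\<beta> M A = P(type in A and message M) / P(message M)\<close>. The second conjunct holds after
  every message, including those off path.\<close>

definition consistent_beliefs ::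
  "(real ^ 'k) set \<Rightarrow> (real ^ 'k) measure \<Rightarrow> (real ^ 'k \<Rightarrow> (real ^ 'k) set set) \<Rightarrow>
   (real ^ 'k \<Rightarrow> (real ^ 'k) set measure) \<Rightarrow> ((real ^ 'k) set \<Rightarrow> (real ^ 'k) measure) \<Rightarrow> bool" where
  "consistent_beliefs T \<mu> Ev \<sigma> \<beta> \<longleftrightarrow>
     (\<forall>A\<in>sets (type_space T). \<forall>B\<in>sets (message_space T Ev).
        (\<integral>\<^sup>+t\<in>A. emeasure (\<sigma> t) B \<partial>restrict_space \<mu> T) =
        (\<integral>\<^sup>+M\<in>B. emeasure (\<beta> M) A \<partial>(restrict_space \<mu> T \<bind> \<sigma>))) \<and>
     (\<forall>M\<in>space (message_space T Ev). AE t in \<beta> M. M \<in> Ev t)"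

definition rational_purchase ::
  "'a set \<Rightarrow> ('a \<Rightarrow> real) \<Rightarrow> ('a \<Rightarrow> 'a set set) \<Rightarrow> ('a \<Rightarrow> 'a set \<Rightarrow> real \<Rightarrow> bool) \<Rightarrow> bool" where
  "rational_purchase T v Ev b \<longleftrightarrow>
     (\<forall>t\<in>T. \<forall>M\<in>Ev t. \<forall>p\<ge>0.
        purchase_payoff v b t M p \<ge> v t - p \<and>
        purchase_payoff v b t M p \<ge> 0 \<and>
        (v t - p = 0 \<longrightarrow> b t M p))"

definition rational_pricing ::
  "(real ^ 'k) set \<Rightarrow> (real ^ 'k \<Rightarrow> (real ^ 'k) set set) \<Rightarrow>
   ((real ^ 'k) set \<Rightarrow> (real ^ 'k) measure) \<Rightarrow> ((real ^ 'k) set \<Rightarrow> real measure) \<Rightarrow>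
   (real ^ 'k \<Rightarrow> (real ^ 'k) set \<Rightarrow> real \<Rightarrow> bool) \<Rightarrow> bool" where
  "rational_pricing T Ev \<beta> \<pi> b \<longleftrightarrow>
     (\<forall>M\<in>space (message_space T Ev). AE p in \<pi> M.
        \<forall>p'\<ge>0. expected_revenue T \<beta> b M p' \<le> expected_revenue T \<beta> b M p)"

definition rational_disclosure ::
  "'a set \<Rightarrow> ('a \<Rightarrow> real) \<Rightarrow> ('a \<Rightarrow> 'a set set) \<Rightarrow> ('a \<Rightarrow> 'a set measure) \<Rightarrow>
   ('a set \<Rightarrow> real measure) \<Rightarrow> ('a \<Rightarrow> 'a set \<Rightarrow> real \<Rightarrow> bool) \<Rightarrow> bool" where
  "rational_disclosure T v Ev \<sigma> \<pi> b \<longleftrightarrow>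
     (\<forall>t\<in>T. AE M in \<sigma> t. \<forall>M'\<in>Ev t. message_payoff v \<pi> b t M' \<le> message_payoff v \<pi> b t M)"

definition perfect_bayesian_equilibrium ::
  "(real ^ 'k) set \<Rightarrow> (real ^ 'k) measure \<Rightarrow> (real ^ 'k \<Rightarrow> real) \<Rightarrow>
   (real ^ 'k \<Rightarrow> (real ^ 'k) set set) \<Rightarrow>
   (real ^ 'k \<Rightarrow> (real ^ 'k) set measure) \<Rightarrow> ((real ^ 'k) set \<Rightarrow> (real ^ 'k) measure) \<Rightarrow>
   ((real ^ 'k) set \<Rightarrow> real measure) \<Rightarrow> (real ^ 'k \<Rightarrow> (real ^ 'k) set \<Rightarrow> real \<Rightarrow> bool) \<Rightarrow> bool" where
  "perfect_bayesian_equilibrium T \<mu> v Ev \<sigma> \<beta> \<pi> b \<longleftrightarrow>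
     assessment T Ev \<sigma> \<beta> \<pi> b \<and>
     consistent_beliefs T \<mu> Ev \<sigma> \<beta> \<and>
     rational_purchase T v Ev b \<and>
     rational_pricing T Ev \<beta> \<pi> b \<and>
     rational_disclosure T v Ev \<sigma> \<pi> b"

end

theory Submission
  imports Defs
begin

text \<open>
  A disclosing type \<open>t\<close> is charged \<open>v t\<close> and gets nothing, so every type with a positive payoff
  from the message \<open>T\<close> sends \<open>T\<close> almost surely. Let \<open>q\<close> be the lowest price in the support of the
  pricing strategy after \<open>T\<close>. All types with \<open>v t > q\<close> pool on \<open>T\<close>, hence for
  \<open>p \<ge> q\<close> the demand after \<open>T\<close> is proportional to the monopoly demand \<open>1 - F p\<close>. If \<open>q\<close> were
  below the lowest monopoly price, some price in \<open>[q, pstar)\<close> charged after \<open>T\<close> would therefore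
  also be an optimal monopoly price.
\<close>

section \<open>Supports and almost sure lower bounds\<close>

text \<open>The complement is the union of all open null sets; second countability reduces it to a
  countable union.\<close>

lemma emeasure_Compl_measure_support:
  fixes M :: "'a::second_countable_topology measure"
  assumes "sets M = sets borel"
  shows "emeasure M (- measure_support M) = 0"
proof -
  define \<F> where "\<F> = {U. open U \<and> emeasure M U = 0}"
  have "\<Union>\<F> = - measure_support M"
    by (auto simp: \<F>_def measure_support_def zero_less_iff_neq_zero)
  moreover obtain \<F>' where "\<F>' \<subseteq> \<F>" "countable \<F>'" "\<Union>\<F>' = \<Union>\<F>"
    using Lindelof[of \<F>] by (auto simp: \<F>_def)
  moreover have "(\<Union>U\<in>\<F>'. U) \<in> null_sets M"
    using \<open>\<F>' \<subseteq> \<F>\<close> \<open>countable \<F>'\<close> assms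
    by (intro null_sets_UN') (auto simp: \<F>_def null_sets_def)
  ultimately show ?thesis by (auto simp: null_sets_def)
qed

text \<open>The almost sure lower bounds attain their supremum: countably many bounds approaching it
  hold simultaneously almost surely.\<close>

lemma AE_le_Sup:
  fixes M :: "real measure"
  assumes "bdd_above {q. AE p in M. q \<le> p}" "{q. AE p in M. q \<le> p} \<noteq> {}"
  shows "AE p in M. Sup {q. AE p in M. q \<le> p} \<le> p"
proof -
  let ?S = "{q. AE p in M. q \<le> p}"
  have "AE p in M. Sup ?S - 1 / real (Suc n) \<le> p" for n
  proof -
    obtain q where q: "q \<in> ?S" "Sup ?S - 1 / real (Suc n) < q"
      using less_cSupE[of "Sup ?S - 1 / real (Suc n)" ?S] assms by auto
    then have "AE p in M. q \<le> p" by simp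
    then show ?thesis by eventually_elim (use q in linarith)
  qed
  then have "AE p in M. \<forall>n. Sup ?S - 1 / real (Suc n) \<le> p"
    by (simp add: AE_all_countable)
  then show ?thesis
  proof eventually_elim
    case (elim p)
    have "Sup ?S \<le> p + e" if e: "0 < e" for e
    proof -
      obtain n where "inverse (real (Suc n)) < e" using reals_Archimedean[OF e] by blast
      then show ?thesis using elim[rule_format, of n] by (simp add: inverse_eq_divide)
    qed
    then show ?case by (rule field_le_epsilon)
  qed
qed

section \<open>The prior and the law of valuations\<close>

context pricing_problem
begin

lemma types_borel: "T \<in> sets borel"
  using compact_types by (simp add: borel_compact)

lemma types_prior: "T \<in> sets \<mu>"
  using types_borel sets_prior by simp

lemma prob_types: "prob T = 1"
proof -
  have "space \<mu> = UNIV" using sets_eq_imp_space_eq[OF sets_prior] by simp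
  moreover have "emeasure \<mu> (- T) = 0"
    using emeasure_Compl_measure_support[OF sets_prior] prior_support by simp
  ultimately show ?thesis
    using prob_compl[OF types_prior] by (simp add: Compl_eq_Diff_UNIV measure_def)
qed

lemma valuation_type_space [measurable]: "v \<in> borel_measurable (type_space T)"
  using valuation_measurable by (simp add: type_space_def)

lemma space_type_space: "space (type_space T) = T"
  by (simp add: type_space_def space_restrict_space)

lemma type_space_sets_prior: "A \<in> sets (type_space T) \<Longrightarrow> A \<in> sets \<mu>"
  using types_borel by (auto simp: type_space_def sets_restrict_space_iff sets_prior)

lemma valuation_sets [measurable]:
  "{t \<in> T. v t \<le> x} \<in> sets (type_space T)"
  "{t \<in> T. x \<le> v t} \<in> sets (type_space T)"
  "{t \<in> T. v t = x} \<in> sets (type_space T)"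
proof -
  have "{t \<in> space (type_space T). v t \<le> x} \<in> sets (type_space T)"
    "{t \<in> space (type_space T). x \<le> v t} \<in> sets (type_space T)"
    "{t \<in> space (type_space T). v t = x} \<in> sets (type_space T)"
    by measurable
  then show "{t \<in> T. v t \<le> x} \<in> sets (type_space T)"
    "{t \<in> T. x \<le> v t} \<in> sets (type_space T)"
    "{t \<in> T. v t = x} \<in> sets (type_space T)"
    by (simp_all add: space_type_space)
qed

text \<open>An atom at \<open>x\<close> would be a jump of the CDF, contradicting its left
  continuity at \<open>x\<close>.\<close>

lemma valuation_no_atoms: "prob {t \<in> T. v t = x} = 0"
proof -
  let ?F = "valuation_cdf T \<mu> v"
  note [measurable] = valuation_sets[THEN type_space_sets_prior]
  have "?F y \<le> ?F x - prob {t \<in> T. v t = x}" if "y < x" for y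
  proof -
    have "prob {t \<in> T. v t \<le> y} + prob {t \<in> T. v t = x}
        = prob ({t \<in> T. v t \<le> y} \<union> {t \<in> T. v t = x})"
      using that by (subst finite_measure_Union) (auto intro: valuation_sets[THEN type_space_sets_prior])
    also have "\<dots> \<le> prob {t \<in> T. v t \<le> x}"
      using that by (intro finite_measure_mono) auto
    finally show ?thesis by (simp add: valuation_cdf_def)
  qed
  then have "eventually (\<lambda>y. ?F y \<le> ?F x - prob {t \<in> T. v t = x}) (at_left x)"
    by (simp add: eventually_at_filter)
  moreover have "(?F \<longlongrightarrow> ?F x) (at_left x)"
    using cdf_continuous continuous_on_eq_continuous_at[of UNIV ?F]
    by (auto simp: isCont_def intro: filterlim_mono at_le)
  ultimately have "?F x \<le> ?F x - prob {t \<in> T. v t = x}"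
    by (intro tendsto_upperbound) auto
  then show ?thesis using measure_nonneg[of \<mu> "{t \<in> T. v t = x}"] by linarith
qed

text \<open>Indifferent types buy, so demand at price \<open>x\<close> includes the types with
  \<open>v t = x\<close>, which the CDF counts too; the overlap is null.\<close>

lemma prob_valuation_ge: "prob {t \<in> T. x \<le> v t} = 1 - valuation_cdf T \<mu> v x"
proof -
  note [measurable] = valuation_sets[THEN type_space_sets_prior] types_prior
  have "prob {t \<in> T. x \<le> v t} + prob {t \<in> T. v t \<le> x}
      = prob ({t \<in> T. x \<le> v t} \<union> {t \<in> T. v t \<le> x}) + prob ({t \<in> T. x \<le> v t} \<inter> {t \<in> T. v t \<le> x})"
    by (subst measure_Un3) (auto simp: fmeasurable_eq_sets)
  also have "{t \<in> T. x \<le> v t} \<union> {t \<in> T. v t \<le> x} = T" by auto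
  also have "{t \<in> T. x \<le> v t} \<inter> {t \<in> T. v t \<le> x} = {t \<in> T. v t = x}" by auto
  finally show ?thesis by (simp add: valuation_no_atoms prob_types valuation_cdf_def)
qed

text \<open>A single type would be an atom of the valuation. This keeps the message \<open>T\<close>
  distinct from every full disclosure.\<close>

lemma types_not_singleton: "T \<noteq> {t}"
proof
  assume "T = {t}"
  then have "{s \<in> T. v s = v t} = T" by auto
  then show False using valuation_no_atoms[of "v t"] prob_types by simp
qed

lemma types_two_points: obtains x y where "x \<in> T" "y \<in> T" "x \<noteq> y"
proof -
  have "T \<noteq> {}" using prob_types by auto
  then show ?thesis using that types_not_singleton by (metis is_singletonI' is_singleton_the_elem)
qed

lemma space_message_space:
  "space (message_space T (simple_evidence T)) = (\<Union>t\<in>T. simple_evidence T t)"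
  unfolding message_space_def by (rule space_measure_of) auto

text \<open>Needed to apply Bayes' rule to the event that \<open>T\<close> is sent.\<close>

lemma full_message_measurable: "{T} \<in> sets (message_space T (simple_evidence T))"
proof -
  obtain x y where xy: "x \<in> T" "y \<in> T" "x \<noteq> y" by (rule types_two_points)
  then obtain U V where UV: "open U" "open V" "x \<in> U" "y \<in> V" "U \<inter> V = {}"
    using separation_t2[THEN iffD1, OF xy(3)] by blast
  let ?\<Omega> = "\<Union>t\<in>T. simple_evidence T t"
  have *: "{M \<in> ?\<Omega>. M \<inter> W \<noteq> {}} \<in> sets (message_space T (simple_evidence T))" if "open W" for W
    unfolding message_space_def using that by (intro in_measure_of) auto
  \<comment> \<open>A singleton cannot meet two disjoint open sets, so only \<open>T\<close> meets
    both.\<close>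
  have "{T} = {M \<in> ?\<Omega>. M \<inter> U \<noteq> {}} \<inter> {M \<in> ?\<Omega>. M \<inter> V \<noteq> {}}"
    using xy UV by (auto simp: simple_evidence_def)
  then show ?thesis using sets.Int[OF *[OF UV(1)] *[OF UV(2)]] by (rule ssubst)
qed

end

section \<open>Immediate consequences of equilibrium\<close>

locale simple_disclosure_equilibrium = pricing_problem T \<mu> v
  for T :: "(real ^ 'k) set" and \<mu> v +
  fixes \<sigma> \<beta> \<pi> b
  assumes equilibrium: "perfect_bayesian_equilibrium T \<mu> v (simple_evidence T) \<sigma> \<beta> \<pi> b"
begin

abbreviation "messages \<equiv> message_space T (simple_evidence T)"

lemma messages_intros: "T \<in> space messages" "t \<in> T \<Longrightarrow> {t} \<in> space messages"
proof -
  obtain x y where "x \<in> T" "y \<in> T" "x \<noteq> y" by (rule types_two_points)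
  then show "T \<in> space messages" "t \<in> T \<Longrightarrow> {t} \<in> space messages"
    by (auto simp: space_message_space simple_evidence_def)
qed

lemma strategies_measurable [measurable]:
  "\<sigma> \<in> measurable (type_space T) (prob_algebra messages)"
  "\<beta> \<in> measurable messages (prob_algebra (type_space T))"
  "\<pi> \<in> measurable messages (prob_algebra price_space)"
  "Measurable.pred (type_space T \<Otimes>\<^sub>M messages \<Otimes>\<^sub>M price_space) (\<lambda>(t, M, p). b t M p)"
  using equilibrium by (auto simp: perfect_bayesian_equilibrium_def assessment_def)

lemma disclosure_kernel:
  assumes "t \<in> T"
  shows "prob_space (\<sigma> t)" "sets (\<sigma> t) = sets messages"
  using measurable_space[OF strategies_measurable(1), of t] assms
  by (auto simp: space_type_space space_prob_algebra)

lemma belief_kernel: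
  assumes "M \<in> space messages"
  shows "prob_space (\<beta> M)" "sets (\<beta> M) = sets (type_space T)"
  using measurable_space[OF strategies_measurable(2) assms] by (auto simp: space_prob_algebra)

lemma pricing_kernel:
  assumes "M \<in> space messages"
  shows "prob_space (\<pi> M)" "sets (\<pi> M) = sets price_space" "space (\<pi> M) = {0..}"
proof -
  show "prob_space (\<pi> M)" and *: "sets (\<pi> M) = sets price_space"
    using measurable_space[OF strategies_measurable(3) assms] by (auto simp: space_prob_algebra)
  show "space (\<pi> M) = {0..}"
    using sets_eq_imp_space_eq[OF *] by (simp add: price_space_def space_restrict_space)
qed

lemma AE_price_nonneg: "M \<in> space messages \<Longrightarrow> AE p in \<pi> M. 0 \<le> p"
  by (rule AE_I2) (simp add: pricing_kernel)

lemma AE_message_feasible: "t \<in> T \<Longrightarrow> AE M in \<sigma> t. M = T \<or> M = {t}"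
  using equilibrium
  by (auto simp: perfect_bayesian_equilibrium_def assessment_def simple_evidence_def)

lemma AE_message_optimal:
  "t \<in> T \<Longrightarrow> AE M in \<sigma> t. \<forall>M'\<in>{T, {t}}. message_payoff v \<pi> b t M' \<le> message_payoff v \<pi> b t M"
  using equilibrium unfolding perfect_bayesian_equilibrium_def rational_disclosure_def
    simple_evidence_def by blast

lemma AE_price_optimal:
  "M \<in> space messages \<Longrightarrow>
    AE p in \<pi> M. \<forall>p'\<ge>0. expected_revenue T \<beta> b M p' \<le> expected_revenue T \<beta> b M p"
  using equilibrium by (auto simp: perfect_bayesian_equilibrium_def rational_pricing_def)

text \<open>Sequential rationality settles all cases but the tie \<open>p = v t\<close>, which is
  broken in favour of buying.\<close>

lemma purchase_iff:
  assumes "t \<in> T" "M \<in> {T, {t}}" "0 \<le> p"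
  shows "b t M p \<longleftrightarrow> p \<le> v t"
proof -
  have "purchase_payoff v b t M p \<ge> v t - p \<and> purchase_payoff v b t M p \<ge> 0
      \<and> (v t - p = 0 \<longrightarrow> b t M p)"
    using equilibrium assms
    unfolding perfect_bayesian_equilibrium_def rational_purchase_def simple_evidence_def by blast
  then show ?thesis by (auto simp: purchase_payoff_def split: if_splits)
qed

lemma message_payoff_eq:
  assumes "t \<in> T" "M \<in> {T, {t}}"
  shows "message_payoff v \<pi> b t M = (\<integral>p. max (v t - p) 0 \<partial>\<pi> M)"
  unfolding message_payoff_def
proof (rule Bochner_Integration.integral_cong[OF refl])
  fix p assume "p \<in> space (\<pi> M)"
  then have "0 \<le> p" using assms messages_intros pricing_kernel(3)[of M] by auto
  then show "purchase_payoff v b t M p = max (v t - p) 0"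
    using purchase_iff[OF assms, of p] by (auto simp: purchase_payoff_def)
qed

text \<open>The surplus lies between 0 and \<open>x\<close> because prices are nonnegative. Without
  integrability, a zero integral could be a mere default value.\<close>

lemma integrable_surplus:
  assumes "M \<in> space messages" "0 \<le> x"
  shows "integrable (\<pi> M) (\<lambda>p. max (x - p) 0)"
proof -
  interpret P: prob_space "\<pi> M" using assms pricing_kernel by simp
  have [measurable_cong]: "sets (\<pi> M) = sets (restrict_space borel {0..})"
    using pricing_kernel(2)[OF assms(1)] by (simp add: price_space_def)
  have "(\<lambda>p. max (x - p) 0) \<in> borel_measurable (restrict_space borel {0::real..})"
    by (rule measurable_restrict_space1) measurable
  then have "(\<lambda>p. max (x - p) 0) \<in> borel_measurable (\<pi> M)" by measurable
  then show ?thesis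
    using AE_price_nonneg[OF assms(1)] assms(2)
    by (intro P.integrable_const_bound[where B = x]) auto
qed

section \<open>Full disclosure leaves no surplus\<close>

text \<open>The feasibility requirement on beliefs gives this even off path: since \<open>T\<close>
  is not a singleton, only type \<open>t\<close> can send \<open>{t}\<close>.\<close>

lemma belief_singleton:
  assumes "t \<in> T"
  shows "AE s in \<beta> {t}. s = t"
proof -
  have "AE s in \<beta> {t}. {t} \<in> simple_evidence T s"
    using equilibrium messages_intros(2)[OF assms]
    by (auto simp: perfect_bayesian_equilibrium_def consistent_beliefs_def)
  then show ?thesis
    by eventually_elim (use types_not_singleton[of t] in \<open>auto simp: simple_evidence_def\<close>)
qed

text \<open>Rationality does not constrain types that cannot send \<open>M\<close>, so measurability
  is taken from the joint measurability of \<open>b\<close>.\<close>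

lemma buyers_measurable:
  assumes "M \<in> space messages" "0 \<le> p"
  shows "{t \<in> T. b t M p} \<in> sets (type_space T)"
proof -
  have "p \<in> space price_space"
    using assms by (simp add: price_space_def space_restrict_space)
  then have "(\<lambda>t. (t, M, p)) \<in> measurable (type_space T) (type_space T \<Otimes>\<^sub>M messages \<Otimes>\<^sub>M price_space)"
    using assms by measurable
  from measurable_compose[OF this strategies_measurable(4)]
  have "Measurable.pred (type_space T) (\<lambda>t. b t M p)" by simp
  then show ?thesis by (simp add: pred_def space_type_space)
qed

text \<open>The belief is concentrated on \<open>t\<close>, so whatever \<open>b\<close> prescribes
  for other types after \<open>{t}\<close> has weight zero.\<close>

lemma revenue_singleton:
  assumes "t \<in> T" "0 \<le> p"
  shows "expected_revenue T \<beta> b {t} p = (if p \<le> v t then p else 0)"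
proof -
  let ?A = "{s \<in> T. b s {t} p}"
  interpret P: prob_space "\<beta> {t}" using assms messages_intros belief_kernel by simp
  have A: "?A \<in> sets (\<beta> {t})"
    using buyers_measurable belief_kernel messages_intros assms by simp
  have *: "t \<in> ?A \<longleftrightarrow> p \<le> v t" using purchase_iff[of t "{t}" p] assms by simp
  show ?thesis
  proof (cases "p \<le> v t")
    case True
    have "AE s in \<beta> {t}. s \<in> ?A"
      using belief_singleton[OF assms(1)] by eventually_elim (use * True in auto)
    then have "P.prob ?A = 1" using A by (simp add: P.prob_eq_1)
    then show ?thesis using True by (simp add: expected_revenue_def)
  next
    case False
    have "AE s in \<beta> {t}. s \<notin> ?A"
      using belief_singleton[OF assms(1)] by eventually_elim (use * False in auto)
    then have "P.prob ?A = 0" using A by (simp add: P.prob_eq_0)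
    then show ?thesis using False by (simp add: expected_revenue_def)
  qed
qed

lemma message_payoff_singleton:
  assumes "t \<in> T"
  shows "message_payoff v \<pi> b t {t} = 0"
proof -
  have M: "{t} \<in> space messages" using messages_intros assms by simp
  have "AE p in \<pi> {t}. v t \<le> p"
    using AE_price_optimal[OF M] AE_price_nonneg[OF M]
  proof eventually_elim
    case (elim p)
    \<comment> \<open>The deviation to \<open>v t\<close> sells for sure and beats every lower
      price.\<close>
    then have "expected_revenue T \<beta> b {t} (v t) \<le> expected_revenue T \<beta> b {t} p"
      using valuation_nonneg assms by simp
    then show ?case
      using elim assms valuation_nonneg[OF assms] by (auto simp: revenue_singleton split: if_splits)
  qed
  then have "AE p in \<pi> {t}. max (v t - p) 0 = 0" by eventually_elim auto
  then show ?thesis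
    using integral_eq_zero_AE by (auto simp: message_payoff_eq assms)
qed

section \<open>The lowest price after the message \<open>T\<close>\<close>

text \<open>This is the essential infimum of the price under \<open>\<pi> T\<close>.\<close>

definition lowest_pooling_price :: real where
  "lowest_pooling_price = Sup {q. AE p in \<pi> T. q \<le> p}"

text \<open>Zero is a lower bound; if the bounds were unbounded, the price would almost surely
  exceed every natural number.\<close>

lemma pooling_price_lower_bounds:
  "bdd_above {q. AE p in \<pi> T. q \<le> p}" "{q. AE p in \<pi> T. q \<le> p} \<noteq> {}"
proof -
  interpret P: prob_space "\<pi> T" using pricing_kernel messages_intros by simp
  show "{q. AE p in \<pi> T. q \<le> p} \<noteq> {}"
    using AE_price_nonneg[OF messages_intros(1)] by blast
  show "bdd_above {q. AE p in \<pi> T. q \<le> p}"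
  proof (rule ccontr)
    assume unbounded: "\<not> bdd_above {q. AE p in \<pi> T. q \<le> p}"
    have "AE p in \<pi> T. real n \<le> p" for n
    proof -
      obtain q where q: "AE p in \<pi> T. q \<le> p" "real n < q"
        using unbounded by (auto simp: bdd_above_def not_le)
      from q(1) show ?thesis by eventually_elim (use q(2) in linarith)
    qed
    then have "AE p in \<pi> T. \<forall>n. real n \<le> p" by (simp add: AE_all_countable)
    then have "AE p in \<pi> T. False"
      by eventually_elim (metis reals_Archimedean2 not_le)
    then show False using P.AE_False by simp
  qed
qed

lemma AE_lowest_pooling_price: "AE p in \<pi> T. lowest_pooling_price \<le> p"
  unfolding lowest_pooling_price_def by (intro AE_le_Sup pooling_price_lower_bounds)

text \<open>A zero payoff would make \<open>v t\<close> an almost sure lower bound of the price,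
  hence at most the essential infimum.\<close>

lemma pooling_payoff_pos:
  assumes "t \<in> T" "lowest_pooling_price < v t"
  shows "0 < message_payoff v \<pi> b t T"
proof (rule ccontr)
  assume "\<not> ?thesis"
  moreover have "0 \<le> (\<integral>p. max (v t - p) 0 \<partial>\<pi> T)" by (rule Bochner_Integration.integral_nonneg) simp
  ultimately have "(\<integral>p. max (v t - p) 0 \<partial>\<pi> T) = 0" using assms by (simp add: message_payoff_eq)
  then have "AE p in \<pi> T. max (v t - p) 0 = 0"
    using integral_nonneg_eq_0_iff_AE[OF integrable_surplus[OF messages_intros(1)]]
      valuation_nonneg assms by simp
  then have "AE p in \<pi> T. v t \<le> p" by eventually_elim (simp add: max_def split: if_splits)
  then have "v t \<le> lowest_pooling_price"
    unfolding lowest_pooling_price_def using pooling_price_lower_bounds by (intro cSup_upper) auto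
  then show False using assms by simp
qed

text \<open>Pooling pays strictly more than the zero payoff from disclosure, so \<open>{t}\<close>
  is not a best reply.\<close>

lemma pooling_prob_one:
  assumes "t \<in> T" "lowest_pooling_price < v t"
  shows "emeasure (\<sigma> t) {T} = 1"
proof -
  interpret P: prob_space "\<sigma> t" using disclosure_kernel assms by simp
  have "AE M in \<sigma> t. M \<in> {T}"
    using AE_message_feasible[OF assms(1)] AE_message_optimal[OF assms(1)]
    by eventually_elim (use pooling_payoff_pos[OF assms] message_payoff_singleton[OF assms(1)] in auto)
  then show ?thesis
    using full_message_measurable disclosure_kernel(2)[OF assms(1)]
    by (intro P.emeasure_eq_1_AE) auto
qed

section \<open>Bayes' rule after the message \<open>T\<close>\<close>

definition pooling_prob :: real where
  "pooling_prob = measure (restrict_space \<mu> T \<bind> \<sigma>) {T}"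

text \<open>Almost every type with \<open>v t\<close> at least \<open>p\<close> sends
  \<open>T\<close>, so the joint probability of this event and \<open>T\<close> is its prior
  probability. The product form also covers \<open>pooling_prob = 0\<close>.\<close>

lemma bayes_pooling:
  assumes "lowest_pooling_price \<le> p"
  shows "measure (\<beta> T) {t \<in> T. p \<le> v t} * pooling_prob = 1 - valuation_cdf T \<mu> v p"
proof -
  let ?A = "{t \<in> T. p \<le> v t}" and ?D = "restrict_space \<mu> T"
  have sets_D: "sets ?D = sets (type_space T)"
    unfolding type_space_def by (rule sets_restrict_space_cong) (rule sets_prior)
  have D: "?D \<in> space (prob_algebra (type_space T))"
    using prob_types types_prior sets_D
    by (auto simp: space_prob_algebra emeasure_eq_measure space_restrict_space emeasure_restrict_space
        sets_eq_imp_space_eq[OF sets_prior] intro!: prob_spaceI)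
  have N: "prob_space (?D \<bind> \<sigma>)" "sets (?D \<bind> \<sigma>) = sets messages"
    \<comment> \<open>The prior is treated as a constant kernel on a dummy source space.\<close>
    using measurable_bind_prob_space[OF measurable_const[OF D] strategies_measurable(1),
        of "count_space UNIV"]
    by (auto simp: space_prob_algebra dest: measurable_space)
  interpret N: prob_space "?D \<bind> \<sigma>" by (rule N(1))
  interpret B: prob_space "\<beta> T" using belief_kernel messages_intros by simp
  \<comment> \<open>Types exactly at the threshold may disclose, but they form a null set.\<close>
  have "AE t in \<mu>. t \<notin> {t \<in> T. v t = lowest_pooling_price}"
    using valuation_no_atoms type_space_sets_prior[OF valuation_sets(3)] by (simp add: prob_eq_0)
  then have "AE t in ?D. t \<notin> {t \<in> T. v t = lowest_pooling_price}"
    using types_prior sets_eq_imp_space_eq[OF sets_prior]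
    by (subst AE_restrict_space_iff) auto
  moreover have "AE t in ?D. t \<in> T"
    by (rule AE_I2) (simp add: space_restrict_space)
  ultimately have AE_D: "AE t in ?D. emeasure (\<sigma> t) {T} * indicator ?A t = indicator ?A t"
    by eventually_elim (use assms in \<open>auto simp: indicator_def intro!: pooling_prob_one\<close>)
  have "ennreal (prob ?A) = emeasure ?D ?A"
    using types_prior sets_eq_imp_space_eq[OF sets_prior]
    by (subst emeasure_restrict_space) (auto simp: emeasure_eq_measure)
  also have "\<dots> = (\<integral>\<^sup>+t\<in>?A. emeasure (\<sigma> t) {T} \<partial>?D)"
    using AE_D sets_D valuation_sets(2)
    by (subst nn_integral_cong_AE[OF AE_D]) simp
  \<comment> \<open>Belief consistency for the type event \<open>?A\<close> and the message event
    \<open>{T}\<close>.\<close>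
  also have "\<dots> = (\<integral>\<^sup>+M\<in>{T}. emeasure (\<beta> M) ?A \<partial>(?D \<bind> \<sigma>))"
    using equilibrium valuation_sets(2) full_message_measurable
    unfolding perfect_bayesian_equilibrium_def consistent_beliefs_def by blast
  also have "\<dots> = (\<integral>\<^sup>+M. emeasure (\<beta> T) ?A * indicator {T} M \<partial>(?D \<bind> \<sigma>))"
    by (intro nn_integral_cong) (auto simp: indicator_def)
  also have "\<dots> = emeasure (\<beta> T) ?A * emeasure (?D \<bind> \<sigma>) {T}"
    using full_message_measurable N(2) by (subst nn_integral_cmult_indicator) auto
  also have "\<dots> = ennreal (measure (\<beta> T) ?A * pooling_prob)"
    by (simp add: B.emeasure_eq_measure N.emeasure_eq_measure pooling_prob_def ennreal_mult)
  finally show ?thesis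
    by (simp add: prob_valuation_ge[symmetric] pooling_prob_def)
qed

section \<open>Comparison with the monopoly price\<close>

text \<open>On this price range, revenue after \<open>T\<close> is monopoly revenue up to a factor
  independent of \<open>p\<close>. Below the range, some potential buyers may have
  disclosed.\<close>

lemma expected_revenue_pooling:
  assumes "0 \<le> p" "lowest_pooling_price \<le> p"
  shows "expected_revenue T \<beta> b T p * pooling_prob = p * (1 - valuation_cdf T \<mu> v p)"
proof -
  have "{t \<in> T. b t T p} = {t \<in> T. p \<le> v t}" using purchase_iff assms by auto
  then show ?thesis using bayes_pooling[OF assms(2)] by (simp add: expected_revenue_def)
qed

lemma AE_pooling_price_ge:
  assumes pstar: "lowest_optimal_monopoly_price T \<mu> v pstar"
  shows "AE p in \<pi> T. pstar \<le> p"
  using AE_price_optimal[OF messages_intros(1)] AE_price_nonneg[OF messages_intros(1)]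
    AE_lowest_pooling_price
proof eventually_elim
  case (elim p)
  show ?case
  proof (rule ccontr)
    assume "\<not> pstar \<le> p"
    then have "p < pstar" by simp
    \<comment> \<open>Since \<open>p < pstar\<close>, both prices are at least
      \<open>lowest_pooling_price\<close>, so both revenues convert to monopoly revenues.\<close>
    then have "expected_revenue T \<beta> b T pstar * pooling_prob \<le> expected_revenue T \<beta> b T p * pooling_prob"
      using elim by (intro mult_right_mono) (auto simp: pooling_prob_def)
    then have "pstar * (1 - valuation_cdf T \<mu> v pstar) \<le> p * (1 - valuation_cdf T \<mu> v p)"
      using elim \<open>p < pstar\<close> by (simp add: expected_revenue_pooling)
    \<comment> \<open>\<open>p\<close> earns at least as much as an optimal price, contradicting
      that \<open>pstar\<close> is the lowest one.\<close>
    then have "optimal_monopoly_price T \<mu> v p"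
      using pstar elim(2) unfolding lowest_optimal_monopoly_price_def optimal_monopoly_price_def
      by (blast intro: order_trans)
    then show False
      using pstar \<open>p < pstar\<close> unfolding lowest_optimal_monopoly_price_def by force
  qed
qed

lemma pooling_payoff_le:
  assumes "lowest_optimal_monopoly_price T \<mu> v pstar" "t \<in> T"
  shows "message_payoff v \<pi> b t T \<le> max (v t - pstar) 0"
proof -
  interpret P: prob_space "\<pi> T" using pricing_kernel messages_intros by simp
  have "AE p in \<pi> T. max (v t - p) 0 \<le> max (v t - pstar) 0"
    using AE_pooling_price_ge[OF assms(1)] by eventually_elim (simp add: max_def)
  then have "(\<integral>p. max (v t - p) 0 \<partial>\<pi> T) \<le> max (v t - pstar) 0"
    using assms(2) valuation_nonneg messages_intros
    by (intro P.integral_le_const integrable_surplus) auto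
  then show ?thesis using assms(2) by (simp add: message_payoff_eq)
qed

text \<open>Each message that \<open>t\<close> can send obeys the bound: \<open>T\<close> by the
  price comparison, \<open>{t}\<close> because it yields zero.\<close>

lemma interim_payoff_le:
  assumes "lowest_optimal_monopoly_price T \<mu> v pstar" "t \<in> T"
  shows "interim_payoff v \<sigma> \<pi> b t \<le> max (v t - pstar) 0"
proof (cases "integrable (\<sigma> t) (message_payoff v \<pi> b t)")
  case True
  interpret P: prob_space "\<sigma> t" using disclosure_kernel assms by simp
  have "AE M in \<sigma> t. message_payoff v \<pi> b t M \<le> max (v t - pstar) 0"
    using AE_message_feasible[OF assms(2)]
    by eventually_elim (use pooling_payoff_le[OF assms] message_payoff_singleton[OF assms(2)] in auto)
  then show ?thesis
    unfolding interim_payoff_def using True by (rule P.integral_le_const[rotated])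
next
  \<comment> \<open>A non-integrable function has Bochner integral 0 by default, and the bound is
    nonnegative.\<close>
  case False
  then show ?thesis by (simp add: interim_payoff_def not_integrable_integral_eq)
qed

end

theorem proposition1:
  fixes T :: "(real ^ 'k) set" and \<mu> :: "(real ^ 'k) measure" and v :: "real ^ 'k \<Rightarrow> real"
    and pstar :: real
    and \<sigma> :: "real ^ 'k \<Rightarrow> (real ^ 'k) set measure"
    and \<beta> :: "(real ^ 'k) set \<Rightarrow> (real ^ 'k) measure"
    and \<pi> :: "(real ^ 'k) set \<Rightarrow> real measure"
    and b :: "real ^ 'k \<Rightarrow> (real ^ 'k) set \<Rightarrow> real \<Rightarrow> bool"
    and t :: "real ^ 'k"
  assumes "pricing_problem T \<mu> v"
    and "lowest_optimal_monopoly_price T \<mu> v pstar"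
    and "perfect_bayesian_equilibrium T \<mu> v (simple_evidence T) \<sigma> \<beta> \<pi> b"
    and "t \<in> T"
  shows "interim_payoff v \<sigma> \<pi> b t \<le> max (v t - pstar) 0"
proof -
  interpret pricing_problem T \<mu> v by fact
  interpret simple_disclosure_equilibrium T \<mu> v \<sigma> \<beta> \<pi> b by unfold_locales fact
  show ?thesis using assms by (intro interim_payoff_le)
qed

end
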